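(* Let $G$ be a connected bipartite cubic graph of order $n$. Then $G$ has an IPD and $\rho(G) \le \frac{n}{3}$.
   Context: All graphs are finite and simple; cubic means $3$-regular. The order of a path is its number of vertices. A path $P$ in $G$ is induced if the subgraph of $G$ induced on $V(P)$ is exactly $P$. An IPD of $G$ is a partition of $V(G)$ into sets $V_1,\dots,V_t$ such that each $G[V_i]$ is a path of order at least $2$; its size is $t$. $\rho(G)$ denotes the smallest size of an IPD of $G$. *)

theory Defs
  imports Main
begin

definition simple_graph :: "'a set \<Rightarrow> ('a \<Rightarrow> 'a \<Rightarrow> bool) \<Rightarrow> bool" where
  "simple_graph V E \<longleftrightarrow> finite V \<and> (\<forall>u v. E u v \<longrightarrow> u \<in> V \<and> v \<in> V)
     \<and> (\<forall>u v. E u v \<longrightarrow> E v u) \<and> (\<forall>v. \<not> E v v)"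

definition degree :: "'a set \<Rightarrow> ('a \<Rightarrow> 'a \<Rightarrow> bool) \<Rightarrow> 'a \<Rightarrow> nat" where
  "degree V E v = card {u \<in> V. E v u}"

definition cubic :: "'a set \<Rightarrow> ('a \<Rightarrow> 'a \<Rightarrow> bool) \<Rightarrow> bool" where
  "cubic V E \<longleftrightarrow> (\<forall>v\<in>V. degree V E v = 3)"

definition is_walk :: "('a \<Rightarrow> 'a \<Rightarrow> bool) \<Rightarrow> 'a list \<Rightarrow> bool" where
  "is_walk E xs \<longleftrightarrow> xs \<noteq> [] \<and> (\<forall>i. Suc i < length xs \<longrightarrow> E (xs ! i) (xs ! Suc i))"

definition connected_graph :: "'a set \<Rightarrow> ('a \<Rightarrow> 'a \<Rightarrow> bool) \<Rightarrow> bool" where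
  "connected_graph V E \<longleftrightarrow> V \<noteq> {} \<and>
     (\<forall>u\<in>V. \<forall>v\<in>V. \<exists>xs. is_walk E xs \<and> hd xs = u \<and> last xs = v)"

definition bipartite :: "'a set \<Rightarrow> ('a \<Rightarrow> 'a \<Rightarrow> bool) \<Rightarrow> bool" where
  "bipartite V E \<longleftrightarrow> (\<exists>A B. A \<union> B = V \<and> A \<inter> B = {} \<and>
     (\<forall>u v. E u v \<longrightarrow> (u \<in> A \<and> v \<in> B) \<or> (u \<in> B \<and> v \<in> A)))"

definition induced_path :: "('a \<Rightarrow> 'a \<Rightarrow> bool) \<Rightarrow> 'a set \<Rightarrow> bool" where
  "induced_path E S \<longleftrightarrow> (\<exists>xs. distinct xs \<and> set xs = S \<and>
     (\<forall>i<length xs. \<forall>j<length xs. E (xs ! i) (xs ! j) \<longleftrightarrow> (i = Suc j \<or> j = Suc i)))"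

definition is_IPD :: "'a set \<Rightarrow> ('a \<Rightarrow> 'a \<Rightarrow> bool) \<Rightarrow> 'a set set \<Rightarrow> bool" where
  "is_IPD V E P \<longleftrightarrow> \<Union>P = V \<and> (\<forall>X\<in>P. \<forall>Y\<in>P. X \<noteq> Y \<longrightarrow> X \<inter> Y = {}) \<and>
     (\<forall>X\<in>P. induced_path E X \<and> card X \<ge> 2)"

definition has_IPD :: "'a set \<Rightarrow> ('a \<Rightarrow> 'a \<Rightarrow> bool) \<Rightarrow> bool" where
  "has_IPD V E \<longleftrightarrow> (\<exists>P. is_IPD V E P)"

definition rho :: "'a set \<Rightarrow> ('a \<Rightarrow> 'a \<Rightarrow> bool) \<Rightarrow> nat" where
  "rho V E = (LEAST t. \<exists>P. is_IPD V E P \<and> card P = t)"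

end

theory Submission
  imports Defs "HOL-Combinatorics.Permutations"
begin

text \<open>In a bipartite graph every path of order 3 is induced, and a path of order 4 is induced unless
  its ends are adjacent. A cycle \<open>c\<^sub>0 c\<^sub>1 \<dots>\<close> of even length \<open>L \<ge> 8\<close> in a cubic graph cannot have both
  chords \<open>c\<^sub>i c\<^sub>i\<^sub>+\<^sub>3\<close> and \<open>c\<^sub>i\<^sub>+\<^sub>3 c\<^sub>i\<^sub>+\<^sub>6\<close>, and this is enough to cut it into paths of order 3 together with
  one induced path of order 4 (\<open>L \<equiv> 1\<close> modulo 3), respectively one of order 5 or two of order 4
  (\<open>L \<equiv> 2\<close>). Hence it suffices to find a 2-factor without 4-cycles.

  Contract every 4-cycle that is disjoint from all other 4-cycles to a single edge. The result is
  again 3-regular and bipartite, so it has a perfect matching by Hall's theorem; the matching lifts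
  to the graph so that it uses an edge of each of these 4-cycles, and none of them is a component of
  the complementary 2-factor. Among the 2-factors with this property take one with the fewest
  cycles. If a component \<open>D\<close> were a 4-cycle, another 4-cycle \<open>v\<^sub>1 v\<^sub>2 v\<^sub>3 v\<^sub>4\<close> would meet it, say with
  \<open>v\<^sub>1 \<notin> D\<close> and \<open>v\<^sub>2 \<in> D\<close>. As degrees are 3, the 2-factor contains \<open>v\<^sub>2 v\<^sub>3\<close> and \<open>v\<^sub>1 v\<^sub>4\<close>, and
  exchanging these for \<open>v\<^sub>1 v\<^sub>2\<close> and \<open>v\<^sub>3 v\<^sub>4\<close> merges two cycles into one.\<close>

section \<open>Perfect matchings in weighted bipartite graphs\<close>

definition hall_condition :: "'a set \<Rightarrow> ('a \<Rightarrow> 'b set) \<Rightarrow> bool" where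
  "hall_condition X N \<longleftrightarrow> (\<forall>S\<subseteq>X. card S \<le> card (\<Union>(N ` S)))"

lemma hall_conditionD: "hall_condition X N \<Longrightarrow> S \<subseteq> X \<Longrightarrow> card S \<le> card (\<Union>(N ` S))"
  by (simp add: hall_condition_def)

lemma not_hall_condition_deleteE:
  assumes "finite X" "hall_condition X N" "\<not> hall_condition X (N(x := N x - {y}))"
  obtains T where "T \<subseteq> X - {x}" "x \<in> X" "card (\<Union>(N ` T) \<union> (N x - {y})) \<le> card T"
proof -
  let ?N = "N(x := N x - {y})"
  obtain S where S: "S \<subseteq> X" "card (\<Union>(?N ` S)) < card S"
    using assms(3) by (auto simp: hall_condition_def not_le)
  have "x \<in> S"
  proof (rule ccontr)
    assume "x \<notin> S"
    then have "?N ` S = N ` S" by (intro image_cong) auto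
    then show False using S hall_conditionD[OF assms(2) S(1)] by simp
  qed
  moreover have "\<Union>(?N ` S) = \<Union>(N ` (S - {x})) \<union> (N x - {y})" using \<open>x \<in> S\<close> by auto
  moreover have "finite S" using S(1) assms(1) by (rule finite_subset)
  ultimately show thesis using S by (intro that[of "S - {x}"]) (auto simp: card_Diff_singleton)
qed

lemma hall_condition_delete_either:
  assumes "finite X" "\<And>x. x \<in> X \<Longrightarrow> finite (N x)" "hall_condition X N" "y \<noteq> z"
  shows "hall_condition X (N(x := N x - {y})) \<or> hall_condition X (N(x := N x - {z}))"
proof (rule ccontr)
  assume "\<not> ?thesis"
  then have violated: "\<not> hall_condition X (N(x := N x - {y}))"
    "\<not> hall_condition X (N(x := N x - {z}))"
    by blast+
  obtain S where S: "S \<subseteq> X - {x}" "x \<in> X"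
    "card (\<Union>(N ` S) \<union> (N x - {y})) \<le> card S" (is "card ?NS \<le> _")
    using not_hall_condition_deleteE[OF assms(1,3) violated(1)] .
  obtain T where T: "T \<subseteq> X - {x}" "x \<in> X"
    "card (\<Union>(N ` T) \<union> (N x - {z})) \<le> card T" (is "card ?NT \<le> _")
    using not_hall_condition_deleteE[OF assms(1,3) violated(2)] .
  have fin: "finite S" "finite T" using S(1) T(1) assms(1) finite_subset by blast+
  have finN: "finite ?NS" "finite ?NT"
    using S(1,2) T(1) assms(2) fin by blast+
  have "Suc (card (S \<union> T)) = card (insert x (S \<union> T))"
    using S(1) T(1) fin by (subst card_insert_disjoint) auto
  also have "\<dots> \<le> card (\<Union>(N ` insert x (S \<union> T)))"
    using S(1,2) T(1) by (intro hall_conditionD[OF assms(3)]) auto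
  also have "\<Union>(N ` insert x (S \<union> T)) = ?NS \<union> ?NT" using \<open>y \<noteq> z\<close> by auto
  finally have union: "card (S \<union> T) < card (?NS \<union> ?NT)" by simp
  have "card (S \<inter> T) \<le> card (\<Union>(N ` (S \<inter> T)))"
    using S(1) by (intro hall_conditionD[OF assms(3)]) auto
  also have "\<dots> \<le> card (?NS \<inter> ?NT)" using finN by (intro card_mono) auto
  finally show False
    using union S(3) T(3) card_Un_Int[OF fin] card_Un_Int[OF finN] by linarith
qed

lemma inj_on_if_hall_condition_singletons:
  assumes "hall_condition X N" "\<And>x. x \<in> X \<Longrightarrow> N x = {f x}"
  shows "inj_on f X"
proof (rule inj_onI)
  fix x y assume "x \<in> X" "y \<in> X" "f x = f y"
  then have "card {x, y} \<le> 1" using hall_conditionD[OF assms(1), of "{x, y}"] assms(2) by simp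
  then show "x = y" by (simp add: card_insert_if split: if_splits)
qed

text \<open>Rado's proof: as long as some neighbourhood has two elements, one of them can be dropped.\<close>

theorem hall_marriage:
  assumes "finite X" "\<And>x. x \<in> X \<Longrightarrow> finite (N x)" "hall_condition X N"
  shows "\<exists>f. inj_on f X \<and> (\<forall>x\<in>X. f x \<in> N x)"
  using assms
proof (induction "\<Sum>x\<in>X. card (N x)" arbitrary: N rule: less_induct)
  case less
  show ?case
  proof (cases "\<exists>x\<in>X. \<exists>y\<in>N x. \<exists>z\<in>N x. y \<noteq> z")
    case True
    then obtain x y z where "x \<in> X" "y \<in> N x" "z \<in> N x" "y \<noteq> z" by blast
    then obtain y where x: "x \<in> X" "y \<in> N x" and hall: "hall_condition X (N(x := N x - {y}))"
      using hall_condition_delete_either[OF less.prems \<open>y \<noteq> z\<close>, of x] by blast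
    let ?N = "N(x := N x - {y})"
    have "(\<Sum>u\<in>X. card (?N u)) < (\<Sum>u\<in>X. card (N u))"
    proof (rule sum_strict_mono_ex1)
      show "\<forall>u\<in>X. card (?N u) \<le> card (N u)" using less.prems(2) by (auto intro: card_mono)
      have "card (N x - {y}) < card (N x)" using x less.prems(2) by (intro card_Diff1_less)
      then show "\<exists>u\<in>X. card (?N u) < card (N u)" using x(1) by (intro bexI[of _ x]) auto
    qed fact
    then have "\<exists>f. inj_on f X \<and> (\<forall>u\<in>X. f u \<in> ?N u)"
    proof (rule less.hyps)
      show "finite (?N u)" if "u \<in> X" for u using less.prems(2)[OF that] by auto
    qed fact+
    then obtain f where f: "inj_on f X" "\<And>u. u \<in> X \<Longrightarrow> f u \<in> ?N u" by blast
    have "f u \<in> N u" if "u \<in> X" for u using f(2)[OF that] by (auto split: if_splits)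
    then show ?thesis using f(1) by blast
  next
    case False
    have "\<exists>y. N x = {y}" if "x \<in> X" for x
    proof -
      have "N x \<noteq> {}" using hall_conditionD[OF less.prems(3), of "{x}"] that by auto
      then show ?thesis using False that by blast
    qed
    then obtain f where f: "\<And>x. x \<in> X \<Longrightarrow> N x = {f x}" by metis
    then have "inj_on f X" by (rule inj_on_if_hall_condition_singletons[OF less.prems(3)])
    then show ?thesis using f by blast
  qed
qed

definition perfect_matching :: "'a set \<Rightarrow> 'b set \<Rightarrow> ('a \<Rightarrow> 'b \<Rightarrow> bool) \<Rightarrow> ('a \<Rightarrow> 'b) \<Rightarrow> bool" where
  "perfect_matching A B G f \<longleftrightarrow> bij_betw f A B \<and> (\<forall>a\<in>A. G a (f a))"

definition regular_weight :: "nat \<Rightarrow> 'a set \<Rightarrow> 'b set \<Rightarrow> ('a \<Rightarrow> 'b \<Rightarrow> nat) \<Rightarrow> bool" where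
  "regular_weight k A B w \<longleftrightarrow> (\<forall>a\<in>A. (\<Sum>b\<in>B. w a b) = k) \<and> (\<forall>b\<in>B. (\<Sum>a\<in>A. w a b) = k)"

lemma regular_weight_card_eq:
  assumes "regular_weight k A B w" "0 < k"
  shows "card A = card B"
proof -
  have "card A * k = (\<Sum>a\<in>A. \<Sum>b\<in>B. w a b)" using assms(1) by (simp add: regular_weight_def)
  also have "\<dots> = (\<Sum>b\<in>B. \<Sum>a\<in>A. w a b)" by (rule sum.swap)
  also have "\<dots> = card B * k" using assms(1) by (simp add: regular_weight_def)
  finally show ?thesis using assms(2) by simp
qed

lemma regular_weight_hall_condition:
  assumes "finite A" "finite B" "0 < k" "regular_weight k A B w"
  shows "hall_condition A (\<lambda>a. {b \<in> B. 0 < w a b})"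
  unfolding hall_condition_def
proof (intro allI impI)
  fix S assume S: "S \<subseteq> A"
  define N where "N = (\<Union>a\<in>S. {b \<in> B. 0 < w a b})"
  have N: "N \<subseteq> B" by (auto simp: N_def)
  have "card S * k = (\<Sum>a\<in>S. \<Sum>b\<in>B. w a b)"
    using assms(4) S by (simp add: regular_weight_def subset_iff)
  also have "\<dots> = (\<Sum>a\<in>S. \<Sum>b\<in>N. w a b)"
    by (intro sum.cong[OF refl] sum.mono_neutral_right) (use assms(2) N in \<open>auto simp: N_def\<close>)
  also have "\<dots> = (\<Sum>b\<in>N. \<Sum>a\<in>S. w a b)" by (rule sum.swap)
  also have "\<dots> \<le> (\<Sum>b\<in>N. \<Sum>a\<in>A. w a b)"
    by (intro sum_mono sum_mono2) (use assms(1) S in auto)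
  also have "\<dots> = card N * k" using assms(4) N by (simp add: regular_weight_def subset_iff)
  finally show "card S \<le> card (\<Union>a\<in>S. {b \<in> B. 0 < w a b})"
    using \<open>0 < k\<close> by (simp add: N_def)
qed

lemma regular_weight_perfect_matching:
  assumes "finite A" "finite B" "0 < k" "regular_weight k A B w"
  shows "\<exists>f. perfect_matching A B (\<lambda>a b. 0 < w a b) f"
proof -
  obtain f where f: "inj_on f A" "\<And>a. a \<in> A \<Longrightarrow> f a \<in> B \<and> 0 < w a (f a)"
    using hall_marriage[OF assms(1) _ regular_weight_hall_condition[OF assms]] assms(2) by auto
  have "f ` A = B"
  proof (rule card_subset_eq[OF assms(2)])
    show "f ` A \<subseteq> B" using f(2) by blast
    show "card (f ` A) = card B"
      using card_image[OF f(1)] regular_weight_card_eq[OF assms(4,3)] by simp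
  qed
  then show ?thesis using f by (auto simp: perfect_matching_def bij_betw_def)
qed

definition heavy_K22 :: "nat \<Rightarrow> 'a set \<Rightarrow> 'b set \<Rightarrow> ('a \<Rightarrow> 'b \<Rightarrow> nat) \<Rightarrow> 'a set \<Rightarrow> 'b set \<Rightarrow> bool" where
  "heavy_K22 k A B w P R \<longleftrightarrow> P \<subseteq> A \<and> R \<subseteq> B \<and> card P = 2 \<and> card R = 2 \<and>
     (\<forall>p\<in>P. \<forall>r\<in>R. 0 < w p r) \<and> k \<le> (\<Sum>p\<in>P. \<Sum>r\<in>R. w p r)"

text \<open>The weight of the graph in which \<open>q\<close> is merged into \<open>p\<close> and \<open>s\<close> into \<open>r\<close>. The weight of the
  edge \<open>pr\<close>, where nothing is truncated if the copy of \<open>K\<^sub>2\<^sub>,\<^sub>2\<close> is heavy, restores regularity; to keep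
  the vertex sets, the redundant vertices \<open>q\<close> and \<open>s\<close> are joined by an edge of weight \<open>k\<close>.\<close>

definition contract_K22 ::
    "nat \<Rightarrow> 'a \<Rightarrow> 'a \<Rightarrow> 'b \<Rightarrow> 'b \<Rightarrow> ('a \<Rightarrow> 'b \<Rightarrow> nat) \<Rightarrow> 'a \<Rightarrow> 'b \<Rightarrow> nat" where
  "contract_K22 k p q r s w a b =
     (if a = q \<and> b = s then k
      else if a = q \<or> b = s then 0
      else if a = p \<and> b = r then w p r + w p s + w q r + w q s - k
      else if a = p then w p b + w q b
      else if b = r then w a r + w a s
      else w a b)"

lemma contract_K22_flip:
  "contract_K22 k p q r s w a b = contract_K22 k r s p q (\<lambda>b a. w a b) b a"
  by (simp add: contract_K22_def ac_simps)

lemma sum_contract_K22: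
  fixes w :: "'a \<Rightarrow> 'b \<Rightarrow> nat"
  assumes "finite B" and r: "r \<in> B" "s \<in> B" "r \<noteq> s" and "p \<in> A" "q \<in> A" "p \<noteq> q"
    and row: "\<And>a. a \<in> A \<Longrightarrow> (\<Sum>b\<in>B. w a b) = k"
    and heavy: "k \<le> w p r + w p s + w q r + w q s" and "a \<in> A"
  shows "(\<Sum>b\<in>B. contract_K22 k p q r s w a b) = k"
proof -
  let ?w = "contract_K22 k p q r s w"
  have split: "sum g B = g r + g s + sum g (B - {r, s})" for g :: "'b \<Rightarrow> nat"
    using sum.subset_diff[of "{r, s}" B g] assms(1) r by simp
  consider (q) "a = q" | (p) "a = p" | (other) "a \<noteq> p" "a \<noteq> q" by blast
  then show ?thesis
  proof cases
    case q
    have "(\<Sum>b\<in>B - {r, s}. ?w a b) = 0" using q by (simp add: contract_K22_def)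
    then show ?thesis using q r by (simp add: split contract_K22_def)
  next
    case p
    have "(\<Sum>b\<in>B - {r, s}. ?w a b) = (\<Sum>b\<in>B - {r, s}. w p b + w q b)"
      by (rule sum.cong) (use p \<open>p \<noteq> q\<close> in \<open>auto simp: contract_K22_def\<close>)
    then show ?thesis
      using p heavy row[OF \<open>p \<in> A\<close>] row[OF \<open>q \<in> A\<close>] r \<open>p \<noteq> q\<close>
      by (simp add: split sum.distrib contract_K22_def)
  next
    case other
    have "(\<Sum>b\<in>B - {r, s}. ?w a b) = (\<Sum>b\<in>B - {r, s}. w a b)"
      by (rule sum.cong) (use other in \<open>auto simp: contract_K22_def\<close>)
    then show ?thesis using other row[OF \<open>a \<in> A\<close>] r by (simp add: split contract_K22_def)
  qed
qed

lemma regular_weight_contract_K22: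
  assumes "finite A" "finite B" "regular_weight k A B w" "heavy_K22 k A B w {p, q} {r, s}"
    and "p \<noteq> q" "r \<noteq> s"
  shows "regular_weight k A B (contract_K22 k p q r s w)"
proof -
  have pq: "p \<in> A" "q \<in> A" and rs: "r \<in> B" "s \<in> B"
    and total: "k \<le> w p r + w p s + w q r + w q s"
    using assms(4-6) by (auto simp: heavy_K22_def)
  have row: "\<And>a. a \<in> A \<Longrightarrow> (\<Sum>b\<in>B. w a b) = k" and col: "\<And>b. b \<in> B \<Longrightarrow> (\<Sum>a\<in>A. w a b) = k"
    using assms(3) by (auto simp: regular_weight_def)
  have "(\<Sum>b\<in>B. contract_K22 k p q r s w a b) = k" if "a \<in> A" for a
    by (rule sum_contract_K22) (use assms pq rs row total that in auto)
  moreover have "(\<Sum>a\<in>A. contract_K22 k p q r s w a b) = k" if "b \<in> B" for b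
    unfolding contract_K22_flip[of k p q]
    by (rule sum_contract_K22) (use assms pq rs col total that in auto)
  ultimately show ?thesis by (simp add: regular_weight_def)
qed

lemma bij_betw_comp_permutes:
  assumes "bij_betw f A B" "\<sigma> permutes P" "P \<subseteq> A" "\<tau> permutes R" "R \<subseteq> B"
  shows "bij_betw (\<tau> \<circ> f \<circ> \<sigma>) A B"
proof -
  have "bij_betw \<sigma> A A" "bij_betw \<tau> B B"
    using assms(2-5) by (auto intro!: permutes_imp_bij elim: permutes_subset)
  then show ?thesis using assms(1) by (auto intro: bij_betw_trans)
qed

text \<open>The edges \<open>p f(p)\<close> and \<open>c r\<close> need only exist up to exchanging \<open>p\<close> with \<open>q\<close> and \<open>r\<close> with \<open>s\<close>:
  the exchanges turn \<open>q s\<close> into another edge of the complete graph between \<open>p, q\<close> and \<open>r, s\<close>.\<close>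

lemma perfect_matching_by_swaps:
  assumes bij: "bij_betw f A B" and "p \<in> A" "q \<in> A" "c \<in> A" and fq: "f q = s" and fc: "f c = r"
    and K22: "\<And>a b. a \<in> {p, q} \<Longrightarrow> b \<in> {r, s} \<Longrightarrow> G a b"
    and fp: "G p (f p) \<or> G q (f p)" and c: "G c r \<or> G c s"
    and rest: "\<And>a. a \<in> A - {p, q, c} \<Longrightarrow> G a (f a)"
  obtains \<sigma> \<tau> where "\<sigma> permutes {p, q}" "\<tau> permutes {r, s}" "perfect_matching A B G (\<tau> \<circ> f \<circ> \<sigma>)"
proof -
  define \<sigma> where "\<sigma> = (if G p (f p) then id else transpose p q)"
  define \<tau> where "\<tau> = (if G c r then id else transpose r s)"
  have \<sigma>: "\<sigma> permutes {p, q}" and \<tau>: "\<tau> permutes {r, s}"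
    by (auto simp: \<sigma>_def \<tau>_def permutes_doubleton_iff)
  have "G a (\<tau> (f (\<sigma> a)))" if a: "a \<in> {p, q}" for a
  proof (cases "f (\<sigma> a) \<in> {r, s}")
    case True
    then have "\<tau> (f (\<sigma> a)) \<in> {r, s}" using permutes_in_image[OF \<tau>] by blast
    then show ?thesis using K22 a by blast
  next
    case False
    then have "\<sigma> a \<noteq> q" using fq by auto
    then have "G a (f (\<sigma> a))" using a fp by (auto simp: \<sigma>_def transpose_def split: if_splits)
    then show ?thesis using permutes_not_in[OF \<tau> False] by simp
  qed
  moreover have "G a (\<tau> (f (\<sigma> a)))" if a: "a \<in> A - {p, q}" for a
  proof (cases "a = c")
    case True
    then show ?thesis using permutes_not_in[OF \<sigma>, of a] a fc c by (auto simp: \<tau>_def)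
  next
    case False
    then have "f a \<notin> {r, s}"
      using bij a \<open>q \<in> A\<close> \<open>c \<in> A\<close> unfolding fq[symmetric] fc[symmetric]
      by (auto simp: bij_betw_def inj_on_eq_iff)
    then show ?thesis
      using permutes_not_in[OF \<sigma>, of a] permutes_not_in[OF \<tau>] rest a False by auto
  qed
  moreover have "{p, q} \<subseteq> A" "{r, s} \<subseteq> B"
    using bij_betwE[OF bij] \<open>p \<in> A\<close> \<open>q \<in> A\<close> \<open>c \<in> A\<close> fq fc by auto
  then have "bij_betw (\<tau> \<circ> f \<circ> \<sigma>) A B" by (intro bij_betw_comp_permutes[OF bij \<sigma> _ \<tau>])
  ultimately show thesis using that[OF \<sigma> \<tau>] by (simp add: perfect_matching_def) (metis DiffI)
qed

lemma perfect_matching_uncontract_K22: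
  assumes "heavy_K22 k A B w {p, q} {r, s}" "p \<noteq> q" "r \<noteq> s"
    and "perfect_matching A B (\<lambda>a b. 0 < contract_K22 k p q r s w a b) f"
  obtains \<sigma> \<tau> where "\<sigma> permutes {p, q}" "\<tau> permutes {r, s}"
    "perfect_matching A B (\<lambda>a b. 0 < w a b) (\<tau> \<circ> f \<circ> \<sigma>)" "f q = s"
proof -
  have pq: "p \<in> A" "q \<in> A" and rs: "r \<in> B" "s \<in> B"
    and K22: "\<And>a b. a \<in> {p, q} \<Longrightarrow> b \<in> {r, s} \<Longrightarrow> 0 < w a b"
    using assms(1) unfolding heavy_K22_def by auto
  have bij: "bij_betw f A B" and pos: "\<And>a. a \<in> A \<Longrightarrow> 0 < contract_K22 k p q r s w a (f a)"
    using assms(4) by (auto simp: perfect_matching_def)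
  have fq: "f q = s" using pos[OF pq(2)] by (simp add: contract_K22_def split: if_splits)
  obtain c where c: "c \<in> A" "f c = r" using bij rs by (auto simp: bij_betw_def)
  have f_eq_iff: "f a = f b \<longleftrightarrow> a = b" if "a \<in> A" "b \<in> A" for a b
    using bij that by (auto simp: bij_betw_def inj_on_eq_iff)
  have "0 < w p (f p) \<or> 0 < w q (f p)"
    using pos[OF pq(1)] K22 assms(2) by (auto simp: contract_K22_def split: if_splits)
  moreover have "0 < w c r \<or> 0 < w c s"
    using pos[OF c(1)] c fq K22 assms(3) by (auto simp: contract_K22_def split: if_splits)
  moreover have "0 < w a (f a)" if "a \<in> A - {p, q, c}" for a
    using that pos[of a] f_eq_iff[of a] c fq pq by (auto simp: contract_K22_def split: if_splits)
  ultimately show thesis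
    using perfect_matching_by_swaps[OF bij pq c(1) fq c(2), of "\<lambda>a b. 0 < w a b"] K22 that fq
    by blast
qed

lemma heavy_K22_contract_K22:
  assumes "heavy_K22 k A B w P R" "P \<inter> {p, q} = {}" "R \<inter> {r, s} = {}"
  shows "heavy_K22 k A B (contract_K22 k p q r s w) P R"
proof -
  have "contract_K22 k p q r s w a b = w a b" if "a \<in> P" "b \<in> R" for a b
    using that assms(2,3) by (auto simp: contract_K22_def)
  then show ?thesis using assms(1) by (simp add: heavy_K22_def)
qed

lemma permutes_image_disjoint:
  assumes "\<sigma> permutes S" "T \<inter> S = {}"
  shows "\<sigma> ` T = T"
proof -
  have "\<sigma> x = x" if "x \<in> T" for x using permutes_not_in[OF assms(1)] assms(2) that by blast
  then show ?thesis by simp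
qed

lemma comp_image_Int_nonempty:
  assumes "f ` S \<inter> T \<noteq> {}" "\<sigma> ` S = S" "\<tau> ` T = T"
  shows "(\<tau> \<circ> f \<circ> \<sigma>) ` S \<inter> T \<noteq> {}"
proof -
  have "(\<tau> \<circ> f \<circ> \<sigma>) ` S = \<tau> ` f ` S" using assms(2) by (metis image_comp)
  moreover have "\<tau> ` (f ` S \<inter> T) \<subseteq> \<tau> ` f ` S \<inter> T" using assms(3) by blast
  ultimately show ?thesis using assms(1) by (metis image_is_empty subset_empty)
qed

lemma perfect_matching_meeting_K22s:
  assumes "finite F" "finite A" "finite B" "0 < k" "regular_weight k A B w"
    and "\<And>P R. (P, R) \<in> F \<Longrightarrow> heavy_K22 k A B w P R"
    and "disjoint_family_on fst F" "disjoint_family_on snd F"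
  shows "\<exists>f. perfect_matching A B (\<lambda>a b. 0 < w a b) f \<and> (\<forall>(P, R)\<in>F. f ` P \<inter> R \<noteq> {})"
  using assms
proof (induction F arbitrary: w rule: finite_induct)
  case empty
  then show ?case using regular_weight_perfect_matching by auto
next
  case (insert t F)
  obtain P R where t: "t = (P, R)" by (cases t)
  have heavy: "heavy_K22 k A B w P R" using insert.prems(5) t by blast
  then obtain p q r s where P: "P = {p, q}" "p \<noteq> q" and R: "R = {r, s}" "r \<noteq> s"
    by (auto simp: heavy_K22_def card_2_iff)
  let ?w = "contract_K22 k p q r s w"
  have disj: "P' \<inter> P = {}" "R' \<inter> R = {}" if "(P', R') \<in> F" for P' R'
  proof -
    have "(P', R') \<noteq> (P, R)" using that insert.hyps t by blast
    then show "P' \<inter> P = {}" "R' \<inter> R = {}"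
      using disjoint_family_onD[OF insert.prems(6), of "(P', R')" "(P, R)"]
        disjoint_family_onD[OF insert.prems(7), of "(P', R')" "(P, R)"] that t by auto
  qed
  have "\<exists>f. perfect_matching A B (\<lambda>a b. 0 < ?w a b) f \<and> (\<forall>(P, R)\<in>F. f ` P \<inter> R \<noteq> {})"
  proof (rule insert.IH)
    show "regular_weight k A B ?w"
      by (rule regular_weight_contract_K22) (use insert.prems heavy P R in auto)
    show "heavy_K22 k A B ?w P' R'" if "(P', R') \<in> F" for P' R'
      using heavy_K22_contract_K22[OF insert.prems(5)] disj[OF that] that unfolding P R by blast
  qed (use insert.prems in \<open>auto simp: disjoint_family_on_def\<close>)
  then obtain f where f: "perfect_matching A B (\<lambda>a b. 0 < ?w a b) f"
    and meets: "\<And>P R. (P, R) \<in> F \<Longrightarrow> f ` P \<inter> R \<noteq> {}" by fast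
  obtain \<sigma> \<tau> where \<sigma>: "\<sigma> permutes P" and \<tau>: "\<tau> permutes R"
    and g: "perfect_matching A B (\<lambda>a b. 0 < w a b) (\<tau> \<circ> f \<circ> \<sigma>)" and "f q = s"
    using perfect_matching_uncontract_K22[OF _ P(2) R(2) f] heavy unfolding P R by metis
  have "(\<tau> \<circ> f \<circ> \<sigma>) ` P \<inter> R \<noteq> {}"
    using \<open>f q = s\<close> P(1) R(1) permutes_image[OF \<sigma>] permutes_image[OF \<tau>]
    by (intro comp_image_Int_nonempty) auto
  moreover have "(\<tau> \<circ> f \<circ> \<sigma>) ` P' \<inter> R' \<noteq> {}" if "(P', R') \<in> F" for P' R'
    using meets[OF that] permutes_image_disjoint[OF \<sigma>] permutes_image_disjoint[OF \<tau>] disj[OF that]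
    by (intro comp_image_Int_nonempty) auto
  ultimately show ?case using g unfolding t by (intro exI[of _ "\<tau> \<circ> f \<circ> \<sigma>"]) blast
qed

section \<open>Cycles and cycle covers\<close>

lemma neighbours_eqI:
  assumes "finite V" "S \<subseteq> {u \<in> V. E v u}" "card S = degree V E v"
  shows "{u \<in> V. E v u} = S"
  using assms by (intro card_subset_eq[symmetric]) (auto simp: degree_def)

definition path :: "('a \<Rightarrow> 'a \<Rightarrow> bool) \<Rightarrow> 'a list \<Rightarrow> bool" where
  "path E xs \<longleftrightarrow> distinct xs \<and> successively E xs"

definition cycle :: "('a \<Rightarrow> 'a \<Rightarrow> bool) \<Rightarrow> 'a list \<Rightarrow> bool" where
  "cycle E xs \<longleftrightarrow> path E xs \<and> 3 \<le> length xs \<and> E (last xs) (hd xs)"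

lemma cycle_mono: "cycle R xs \<Longrightarrow> (\<And>x y. R x y \<Longrightarrow> E x y) \<Longrightarrow> cycle E xs"
  unfolding cycle_def path_def by (blast intro: successively_mono)

lemma cycle_rev: "cycle E xs \<Longrightarrow> symp E \<Longrightarrow> cycle E (rev xs)"
  by (auto simp: cycle_def path_def hd_rev last_rev symp_def elim: successively_mono)

lemma cycle_append_commute: "cycle E (xs @ ys) \<Longrightarrow> cycle E (ys @ xs)"
  by (cases "xs = []"; cases "ys = []") (auto simp: cycle_def path_def successively_append_iff)

lemma cycle_append:
  assumes "cycle E xs" "cycle E ys" "set xs \<inter> set ys = {}"
    and "E (last xs) (hd ys)" "E (last ys) (hd xs)"
  shows "cycle E (xs @ ys)"
  using assms by (auto simp: cycle_def path_def successively_append_iff hd_append last_append)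

lemma length_cycle: "cycle E xs \<Longrightarrow> length xs = card (set xs)"
  by (simp add: cycle_def path_def distinct_card)

lemma cycle_rotate_to:
  assumes "cycle E xs" "x \<in> set xs"
  obtains zs where "cycle E (x # zs)" "set xs = set (x # zs)"
proof -
  obtain us vs where "xs = us @ x # vs" using assms(2) by (meson split_list)
  then show thesis using that[of "vs @ us"] cycle_append_commute[of E us "x # vs"] assms(1) by auto
qed

lemma cycle_rotate_entering:
  assumes "cycle E xs" "set xs \<inter> S \<noteq> {}" "\<not> set xs \<subseteq> S"
  obtains u v zs where "cycle E (u # v # zs)" "set xs = set (u # v # zs)" "u \<notin> S" "v \<in> S"
proof -
  obtain x where "x \<in> set xs" "x \<notin> S" using assms(3) by blast
  then obtain ys where ys: "cycle E (x # ys)" "set xs = set (x # ys)"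
    using cycle_rotate_to[OF assms(1)] by blast
  have "\<exists>y\<in>set ys. y \<in> S" using assms(2) ys(2) \<open>x \<notin> S\<close> by auto
  then obtain us v vs where split: "ys = us @ v # vs" "v \<in> S" "\<forall>u\<in>set us. u \<notin> S"
    using split_list_first_prop[of ys "\<lambda>y. y \<in> S"] by blast
  obtain as u where as: "x # us = as @ [u]" by (metis rev_exhaust list.distinct(1))
  have "cycle E (as @ u # v # vs)" using ys(1) as split(1)
    by (metis append_Cons append_assoc append_Nil)
  then have "cycle E (u # v # vs @ as)" using cycle_append_commute by fastforce
  moreover have "set xs = set (u # v # vs @ as)"
  proof -
    have "set xs = set (x # us) \<union> set (v # vs)" using ys(2) split(1) by auto
    then show ?thesis unfolding as by auto
  qed
  moreover have "u \<in> set (x # us)" unfolding as by simp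
  then have "u \<notin> S" using \<open>x \<notin> S\<close> split(3) by auto
  ultimately show thesis using that split(2) by blast
qed

lemma cycle_ConsE:
  assumes "cycle E (x # zs)"
  obtains y ys z where "zs = y # ys @ [z]" "y \<noteq> z" "E x y" "E z x"
proof -
  have "2 \<le> length zs" using assms by (simp add: cycle_def)
  then obtain y us where y: "zs = y # us" "us \<noteq> []"
    by (auto simp: numeral_2_eq_2 Suc_le_length_iff)
  then obtain ys z where "us = ys @ [z]" by (metis rev_exhaust)
  then show thesis using that[of y ys z] y assms by (auto simp: cycle_def path_def)
qed

lemma cycle_two_neighbours:
  assumes "cycle E xs" "symp E" "x \<in> set xs"
  obtains y z where "y \<in> set xs" "z \<in> set xs" "y \<noteq> z" "E x y" "E x z"
proof -
  obtain zs where zs: "cycle E (x # zs)" "set xs = set (x # zs)"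
    using cycle_rotate_to[OF assms(1,3)] .
  obtain y ys z where "zs = y # ys @ [z]" "y \<noteq> z" "E x y" "E z x"
    using cycle_ConsE[OF zs(1)] .
  then show thesis using that[of y z] zs(2) sympD[OF assms(2)] by simp
qed

text \<open>Of the three edges at \<open>v\<close>, only \<open>vx\<close> is missing from the cycle.\<close>

lemma cycle_through_edge:
  assumes "cycle E xs" "symp E" "finite V" "set xs \<subseteq> V" "v \<in> set xs" "degree V E v = 3"
    and "E v x" "x \<in> V - set xs" "E v y" "y \<in> V" "y \<noteq> x"
  obtains ys where "cycle E ys" "set ys = set xs" "hd ys = y" "last ys = v"
proof -
  obtain zs where zs: "cycle E (v # zs)" "set xs = set (v # zs)"
    using cycle_rotate_to[OF assms(1,5)] .
  obtain b bs c where bc: "zs = b # bs @ [c]" "b \<noteq> c" "E v b" "E c v"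
    using cycle_ConsE[OF zs(1)] .
  have "{u \<in> V. E v u} = {x, b, c}"
  proof (rule neighbours_eqI[OF assms(3)])
    show "{x, b, c} \<subseteq> {u \<in> V. E v u}"
      using assms(4,7,8) bc zs(2) sympD[OF assms(2)] by auto
    have "b \<noteq> x" "c \<noteq> x" using assms(8) bc zs(2) by auto
    then show "card {x, b, c} = degree V E v" using assms(6) bc(2) by simp
  qed
  then consider (first) "y = b" | (last) "y = c" using assms(9-11) by blast
  then show thesis
  proof cases
    case first
    have "cycle E (zs @ [v])" using cycle_append_commute[of E "[v]" zs] zs(1) by simp
    then show thesis using that[of "zs @ [v]"] zs(2) bc(1) first by auto
  next
    case last
    then show thesis using that[of "rev (v # zs)"] cycle_rev[OF zs(1) assms(2)] zs(2) bc(1) by auto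
  qed
qed

lemma min_degree_2_has_cycle:
  assumes "finite V" "V \<noteq> {}" "symp R" "irreflp R" and deg: "\<And>v. v \<in> V \<Longrightarrow> 2 \<le> degree V R v"
  obtains zs where "cycle R zs" "set zs \<subseteq> V"
proof -
  define in_V where "in_V xs \<longleftrightarrow> path R xs \<and> set xs \<subseteq> V" for xs
  obtain v where "v \<in> V" using assms(2) by blast
  then have "in_V [v]" by (simp add: in_V_def path_def)
  moreover have "\<forall>xs. in_V xs \<longrightarrow> length xs \<le> card V"
    using assms(1) by (metis in_V_def path_def card_mono distinct_card)
  ultimately obtain xs where xs: "in_V xs" and longest: "\<And>ys. in_V ys \<Longrightarrow> length ys \<le> length xs"
    using ex_has_greatest_nat[of in_V "[v]" length "Suc (card V)"] le_imp_less_Suc by blast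
  obtain z ys where zys: "xs = z # ys" using longest[OF \<open>in_V [v]\<close>] by (cases xs) auto
  have "\<not> {u \<in> V. R z u} \<subseteq> {hd ys}"
    using deg[of z] xs card_mono[of "{hd ys}" "{u \<in> V. R z u}"]
    by (auto simp: zys in_V_def degree_def)
  then obtain u where u: "u \<in> V" "R z u" "u \<noteq> hd ys" by blast
  have "u \<in> set ys"
  proof (rule ccontr)
    assume "u \<notin> set ys"
    moreover have "u \<noteq> z" using u(2) \<open>irreflp R\<close> by (auto simp: irreflp_def)
    ultimately have "in_V (u # xs)"
      using xs u sympD[OF assms(3)] by (simp add: in_V_def path_def zys)
    then show False using longest by fastforce
  qed
  then obtain as bs where ys: "ys = as @ u # bs" by (meson split_list)
  then have "as \<noteq> []" using u(3) by auto
  then have "cycle R (z # as @ [u])"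
    using xs u(2) sympD[OF assms(3)]
    by (auto simp: in_V_def path_def cycle_def zys ys successively_append_iff
        successively_Cons neq_Nil_conv)
  then show thesis using that xs by (auto simp: in_V_def zys ys)
qed

definition cycle_cover :: "('a \<Rightarrow> 'a \<Rightarrow> bool) \<Rightarrow> 'a set \<Rightarrow> 'a list set \<Rightarrow> bool" where
  "cycle_cover E V Q \<longleftrightarrow> finite Q \<and> (\<forall>xs\<in>Q. cycle E xs) \<and> (\<Union>xs\<in>Q. set xs) = V \<and>
     disjoint_family_on set Q"

lemma cycle_cover_mono:
  "cycle_cover R V Q \<Longrightarrow> (\<And>x y. R x y \<Longrightarrow> E x y) \<Longrightarrow> cycle_cover E V Q"
  unfolding cycle_cover_def by (blast intro: cycle_mono)

lemma cycle_cover_insert: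
  assumes "cycle_cover E V Q" "cycle E zs" "set zs \<inter> V = {}"
  shows "cycle_cover E (set zs \<union> V) (insert zs Q)"
  using assms by (fastforce simp: cycle_cover_def disjoint_family_on_def)

lemma cycle_cover_replace:
  assumes "cycle_cover E V Q" "P \<subseteq> Q" "cycle E zs" "set zs = (\<Union>xs\<in>P. set xs)"
  shows "cycle_cover E V (insert zs (Q - P))"
proof -
  have disj: "set zs \<inter> (\<Union>xs\<in>Q - P. set xs) = {}"
    using assms(1,2,4) unfolding cycle_cover_def disjoint_family_on_def by fastforce
  have "cycle_cover E (\<Union>xs\<in>Q - P. set xs) (Q - P)"
    using assms(1) by (auto simp: cycle_cover_def disjoint_family_on_def)
  then have "cycle_cover E (set zs \<union> (\<Union>xs\<in>Q - P. set xs)) (insert zs (Q - P))"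
    using assms(3) disj by (rule cycle_cover_insert)
  moreover have "set zs \<union> (\<Union>xs\<in>Q - P. set xs) = V"
    using assms(1,2,4) by (auto simp: cycle_cover_def)
  ultimately show ?thesis by simp
qed

lemma two_regular_cycle_closed:
  assumes "finite V" "symp R" "cycle R zs" "set zs \<subseteq> V" "v \<in> set zs" "degree V R v = 2"
  shows "{u \<in> V. R v u} \<subseteq> set zs"
proof -
  obtain y z where yz: "y \<in> set zs" "z \<in> set zs" "y \<noteq> z" "R v y" "R v z"
    using cycle_two_neighbours[OF assms(3,2,5)] .
  have "{u \<in> V. R v u} = {y, z}"
    using yz assms(4,6) by (intro neighbours_eqI[OF assms(1)]) auto
  then show ?thesis using yz(1,2) by simp
qed

lemma two_regular_cycle_cover:
  assumes "finite V" "symp R" "irreflp R" "\<And>v. v \<in> V \<Longrightarrow> degree V R v = 2"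
  shows "\<exists>Q. cycle_cover R V Q"
  using assms(1,4)
proof (induction V rule: finite_psubset_induct)
  case (psubset V)
  show ?case
  proof (cases "V = {}")
    case True
    then show ?thesis by (auto simp: cycle_cover_def disjoint_family_on_def intro: exI[of _ "{}"])
  next
    case False
    then obtain zs where zs: "cycle R zs" "set zs \<subseteq> V"
      using min_degree_2_has_cycle[OF psubset.hyps(1) False assms(2,3)] psubset.prems by auto
    have closed: "{u \<in> V. R v u} \<subseteq> set zs" if "v \<in> set zs" for v
      by (rule two_regular_cycle_closed[OF psubset.hyps(1) assms(2) zs that])
        (use psubset.prems zs(2) that in blast)
    have "\<exists>Q. cycle_cover R (V - set zs) Q"
    proof (rule psubset.IH)
      show "V - set zs \<subset> V" using zs by (cases zs) (auto simp: cycle_def)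
      show "degree (V - set zs) R v = 2" if v: "v \<in> V - set zs" for v
      proof -
        have "{u \<in> V - set zs. R v u} = {u \<in> V. R v u}"
          using closed v zs(2) sympD[OF assms(2)] by blast
        then show ?thesis using psubset.prems[of v] v by (simp add: degree_def)
      qed
    qed
    then obtain Q where "cycle_cover R (V - set zs) Q" by blast
    then have "cycle_cover R (set zs \<union> (V - set zs)) (insert zs Q)"
      using zs(1) by (rule cycle_cover_insert) blast
    then show ?thesis using zs(2) by (auto simp: Un_absorb1)
  qed
qed

lemma cycle_merge_along_four_cycle:
  assumes xs: "cycle E xs" "set xs \<subseteq> V" and ys: "cycle E ys" "set ys \<subseteq> V"
    and disj: "set xs \<inter> set ys = {}"
    and "finite V" and sym: "symp E" and cubic: "\<And>v. v \<in> V \<Longrightarrow> degree V E v = 3"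
    and C4: "cycle E [v1, v2, v3, v4]" "set [v1, v2, v3, v4] \<subseteq> V" "v1 \<in> set xs" "v2 \<in> set ys"
  obtains zs where "cycle E zs" "set zs = set xs \<union> set ys"
proof -
  have E: "E v1 v2" "E v2 v3" "E v3 v4" "E v1 v4" "E v2 v1" and ne: "v1 \<noteq> v3" "v2 \<noteq> v4"
    using C4(1) sympD[OF sym] by (auto simp: cycle_def path_def)
  obtain as where as: "cycle E as" "set as = set xs" "hd as = v4" "last as = v1"
    using cycle_through_edge[OF xs(1) sym \<open>finite V\<close> xs(2) C4(3) cubic E(1) _ E(4)] C4 disj ne
    by auto
  obtain bs where bs: "cycle E bs" "set bs = set ys" "hd bs = v3" "last bs = v2"
    using cycle_through_edge[OF ys(1) sym \<open>finite V\<close> ys(2) C4(4) cubic E(5) _ E(2)] C4 disj ne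
    by auto
  have "cycle E (as @ rev bs)"
    using cycle_append[OF as(1) cycle_rev[OF bs(1) sym]] as bs disj E
    by (simp add: hd_rev last_rev)
  then show thesis using that[of "as @ rev bs"] as(2) bs(2) by simp
qed

lemma cycle_cover_merge:
  assumes Q: "cycle_cover E V Q" and "symp E" and "\<And>v. v \<in> V \<Longrightarrow> degree V E v = 3"
    and xs: "xs \<in> Q" and C4: "cycle E [v1, v2, v3, v4]" "set [v1, v2, v3, v4] \<subseteq> V"
    and v: "v1 \<notin> set xs" "v2 \<in> set xs"
  shows "\<exists>Q'. cycle_cover E V Q' \<and> card Q' < card Q \<and> (\<forall>zs\<in>Q'. zs \<in> Q \<or> length xs < length zs)"
proof -
  have cyc: "\<And>xs. xs \<in> Q \<Longrightarrow> cycle E xs" and V: "(\<Union>xs\<in>Q. set xs) = V" and "finite Q"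
    using Q by (auto simp: cycle_cover_def)
  have "finite V" using V \<open>finite Q\<close> by blast
  obtain ys where ys: "ys \<in> Q" "v1 \<in> set ys" using C4(2) V by auto
  then have "ys \<noteq> xs" using v(1) by blast
  then have disj: "set ys \<inter> set xs = {}"
    using Q ys(1) xs by (simp add: cycle_cover_def disjoint_family_on_def)
  have sub: "set ys \<subseteq> V" "set xs \<subseteq> V" using V ys(1) xs by auto
  obtain zs where zs: "cycle E zs" "set zs = set ys \<union> set xs"
    using cycle_merge_along_four_cycle[OF cyc[OF ys(1)] sub(1) cyc[OF xs] sub(2) disj \<open>finite V\<close>
        assms(2,3) C4 ys(2) v(2)] .
  have "cycle_cover E V (insert zs (Q - {xs, ys}))"
    by (rule cycle_cover_replace[OF Q _ zs(1)]) (use zs(2) xs ys(1) in auto)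
  moreover have "card (insert zs (Q - {xs, ys})) < card Q"
  proof -
    have "card {xs, ys} \<le> card Q" using \<open>finite Q\<close> xs ys(1) by (intro card_mono) auto
    then show ?thesis
      using xs ys(1) \<open>ys \<noteq> xs\<close> \<open>finite Q\<close> by (auto simp: card_insert_if card_Diff_subset)
  qed
  moreover have "length xs < length zs"
  proof -
    have "set xs \<subset> set zs" using zs(2) ys(2) v(1) by blast
    then show ?thesis
      using length_cycle[OF zs(1)] length_cycle[OF cyc[OF xs]] by (simp add: psubset_card_mono)
  qed
  ultimately show ?thesis by blast
qed

section \<open>Cutting cycles into induced paths\<close>

definition small_IPD :: "'a set \<Rightarrow> ('a \<Rightarrow> 'a \<Rightarrow> bool) \<Rightarrow> bool" where
  "small_IPD V E \<longleftrightarrow> (\<exists>P. is_IPD V E P \<and> 3 * card P \<le> card V)"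

lemma small_IPD_empty: "small_IPD {} E"
  unfolding small_IPD_def by (rule exI[of _ "{}"]) (simp add: is_IPD_def)

lemma small_IPD_induced_path: "induced_path E S \<Longrightarrow> 3 \<le> card S \<Longrightarrow> small_IPD S E"
  unfolding small_IPD_def by (rule exI[of _ "{S}"]) (simp add: is_IPD_def)

lemma small_IPD_Un:
  assumes "small_IPD S E" "small_IPD T E" "S \<inter> T = {}" "finite S" "finite T"
  shows "small_IPD (S \<union> T) E"
proof -
  obtain P Q where P: "is_IPD S E P" "3 * card P \<le> card S"
    and Q: "is_IPD T E Q" "3 * card Q \<le> card T"
    using assms(1,2) by (auto simp: small_IPD_def)
  have "X \<inter> Y = {} \<and> Y \<inter> X = {}" if "X \<in> P" "Y \<in> Q" for X Y
    using P(1) Q(1) assms(3) that unfolding is_IPD_def by blast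
  then have "is_IPD (S \<union> T) E (P \<union> Q)"
    using P(1) Q(1) unfolding is_IPD_def by (simp add: ball_Un)
  moreover have "3 * card (P \<union> Q) \<le> card (S \<union> T)"
    using card_Un_le[of P Q] P(2) Q(2) card_Un_disjoint[OF assms(4,5,3)] by linarith
  ultimately show ?thesis unfolding small_IPD_def by blast
qed

lemma small_IPD_UN:
  assumes "finite Q" "disjoint_family_on S Q" "\<And>q. q \<in> Q \<Longrightarrow> finite (S q) \<and> small_IPD (S q) E"
  shows "small_IPD (\<Union>q\<in>Q. S q) E"
  using assms
proof (induction Q rule: finite_induct)
  case empty
  then show ?case by (simp add: small_IPD_empty)
next
  case (insert q Q)
  have "small_IPD (S q \<union> (\<Union>q\<in>Q. S q)) E"
  proof (rule small_IPD_Un)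
    show "S q \<inter> (\<Union>q\<in>Q. S q) = {}"
      using insert.hyps(2) insert.prems(1) by (fastforce simp: disjoint_family_on_def)
    show "small_IPD (\<Union>q\<in>Q. S q) E"
      using insert.IH insert.prems by (simp add: disjoint_family_on_def)
  qed (use insert in auto)
  then show ?case by simp
qed

lemma small_IPD_imp_has_IPD_rho_le:
  assumes "small_IPD V E"
  shows "has_IPD V E \<and> 3 * rho V E \<le> card V"
proof -
  obtain P where P: "is_IPD V E P" "3 * card P \<le> card V" using assms by (auto simp: small_IPD_def)
  have "rho V E \<le> card P" unfolding rho_def by (rule Least_le) (use P(1) in blast)
  then show ?thesis using P by (auto simp: has_IPD_def)
qed

locale bipartite_graph =
  fixes A B :: "'a set" and E :: "'a \<Rightarrow> 'a \<Rightarrow> bool"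
  assumes simple: "simple_graph (A \<union> B) E" and disjoint: "A \<inter> B = {}"
    and edge: "E u v \<Longrightarrow> (u \<in> A \<and> v \<in> B) \<or> (u \<in> B \<and> v \<in> A)"
begin

lemma finite_A: "finite A" and finite_B: "finite B" and symp_E: "symp E" and irreflp_E: "irreflp E"
  using simple by (auto simp: simple_graph_def symp_def irreflp_def)

lemma edge_colour: "E u v \<Longrightarrow> u \<in> A \<longleftrightarrow> v \<notin> A"
  using edge disjoint by blast

lemma successively_alternates:
  "successively E xs \<Longrightarrow> i < length xs \<Longrightarrow> xs ! i \<in> A \<longleftrightarrow> (xs ! 0 \<in> A \<longleftrightarrow> even i)"
proof (induction i)
  case (Suc i)
  have "E (xs ! i) (xs ! Suc i)" using Suc.prems successively_nth[of E xs i] by simp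
  then show ?case using Suc edge_colour by auto
qed simp

lemma odd_distance:
  assumes "successively E xs" "i < length xs" "j < length xs" "E (xs ! i) (xs ! j)"
  shows "odd (i + j)"
  using edge_colour[OF assms(4)] successively_alternates[OF assms(1,2)]
    successively_alternates[OF assms(1,3)] by auto

lemma even_length_cycle:
  assumes "cycle E xs"
  shows "even (length xs)"
proof -
  have "xs \<noteq> []" "successively E xs" "E (last xs) (hd xs)"
    using assms by (auto simp: cycle_def path_def)
  then have "odd (length xs - 1 + 0)"
    by (intro odd_distance) (auto simp: hd_conv_nth last_conv_nth)
  then show ?thesis by presburger
qed

lemma set_cycle_subset: "cycle E xs \<Longrightarrow> set xs \<subseteq> A \<union> B"
  using cycle_two_neighbours[OF _ symp_E] edge by blast

lemma induced_path_if_no_long_chord: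
  assumes "path E xs"
    and no_chord: "\<And>i j. i + 3 \<le> j \<Longrightarrow> j < length xs \<Longrightarrow> \<not> E (xs ! i) (xs ! j)"
  shows "induced_path E (set xs)"
proof -
  have path: "distinct xs" "successively E xs" using assms(1) by (auto simp: path_def)
  have consecutive: "j = Suc i" if "E (xs ! i) (xs ! j)" "i \<le> j" "j < length xs" for i j
  proof -
    have "odd (i + j)" using odd_distance[OF path(2) _ _ that(1)] that(2,3) by simp
    moreover have "j < i + 3" using no_chord that by (meson not_le)
    ultimately show ?thesis using that(2) by presburger
  qed
  have "E (xs ! i) (xs ! j) \<longleftrightarrow> (i = Suc j \<or> j = Suc i)" if "i < length xs" "j < length xs" for i j
  proof
    assume "E (xs ! i) (xs ! j)"
    then show "i = Suc j \<or> j = Suc i"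
      using consecutive[of i j] consecutive[of j i] sympD[OF symp_E] that nat_le_linear by blast
  next
    assume "i = Suc j \<or> j = Suc i"
    then show "E (xs ! i) (xs ! j)"
      using successively_nth[OF path(2)] sympD[OF symp_E] that by auto
  qed
  then show ?thesis unfolding induced_path_def using path(1) by blast
qed

lemma small_IPD_short_path:
  assumes "path E xs" "3 \<le> length xs" "length xs \<le> 5"
    and no_chord: "\<And>i. i + 3 < length xs \<Longrightarrow> \<not> E (xs ! i) (xs ! (i + 3))"
  shows "small_IPD (set xs) E"
proof (rule small_IPD_induced_path)
  show "induced_path E (set xs)"
  proof (rule induced_path_if_no_long_chord[OF assms(1)])
    fix i j assume ij: "i + 3 \<le> j" "j < length xs"
    show "\<not> E (xs ! i) (xs ! j)"
    proof
      assume chord: "E (xs ! i) (xs ! j)"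
      then have "odd (i + j)" using assms(1) ij by (intro odd_distance) (auto simp: path_def)
      then have "j = i + 3" using ij assms(3) by presburger
      then show False using no_chord chord ij(2) by simp
    qed
  qed
  show "3 \<le> card (set xs)" using assms(1,2) by (simp add: path_def distinct_card)
qed

lemma small_IPD_append:
  assumes "path E (xs @ ys)" "small_IPD (set xs) E" "small_IPD (set ys) E"
  shows "small_IPD (set (xs @ ys)) E"
  using small_IPD_Un[OF assms(2,3)] assms(1) by (simp add: path_def)

lemma small_IPD_path:
  "path E xs \<Longrightarrow> 3 dvd length xs \<Longrightarrow> small_IPD (set xs) E"
proof (induction "length xs" arbitrary: xs rule: less_induct)
  case less
  show ?case
  proof (cases "xs = []")
    case False
    then have "3 \<le> length xs" using less.prems(2) by (simp add: dvd_imp_le)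
    have path: "path E (take 3 xs @ drop 3 xs)" using less.prems(1) by simp
    then have "path E (take 3 xs)" "path E (drop 3 xs)"
      unfolding path_def successively_append_iff distinct_append by blast+
    then have "small_IPD (set (take 3 xs)) E" "small_IPD (set (drop 3 xs)) E"
      using less.hyps[of "drop 3 xs"] less.prems(2) \<open>3 \<le> length xs\<close>
      by (auto intro!: small_IPD_short_path)
    then show ?thesis using small_IPD_append[OF path] by simp
  qed (simp add: small_IPD_empty)
qed

lemma small_IPD_append_path:
  assumes "path E (xs @ ys)" "small_IPD (set xs) E" "3 dvd length ys"
  shows "small_IPD (set (xs @ ys)) E"
proof (rule small_IPD_append[OF assms(1,2)])
  show "small_IPD (set ys) E"
    using assms(1,3) by (intro small_IPD_path) (auto simp: path_def successively_append_iff)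
qed

lemma small_IPD_4:
  assumes "path E [a, b, c, d]" "\<not> E a d"
  shows "small_IPD {a, b, c, d} E"
  using small_IPD_short_path[OF assms(1)] assms(2) by simp

lemma small_IPD_5:
  assumes "path E [a, b, c, d, e]" "\<not> E a d" "\<not> E b e"
  shows "small_IPD {a, b, c, d, e} E"
proof -
  have "\<not> E ([a, b, c, d, e] ! i) ([a, b, c, d, e] ! (i + 3))"
    if "i + 3 < length [a, b, c, d, e]" for i
  proof -
    have "i = 0 \<or> i = 1" using that by auto
    then show ?thesis using assms(2,3) by auto
  qed
  then show ?thesis using small_IPD_short_path[OF assms(1)] by simp
qed

end

locale bipartite_cubic_graph = bipartite_graph +
  assumes cubic: "cubic (A \<union> B) E"
begin

lemma degree_3: "v \<in> A \<union> B \<Longrightarrow> degree (A \<union> B) E v = 3"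
  using cubic by (simp add: cubic_def)

lemma no_consecutive_chords:
  assumes "path E (v0 # v1 # v2 # v3 # v4 # v5 # v6 # vs)" "E v0 v3"
  shows "\<not> E v3 v6"
proof
  assume "E v3 v6"
  then have "{v0, v2, v4, v6} \<subseteq> {u \<in> A \<union> B. E v3 u}"
    using assms edge sympD[OF symp_E] unfolding path_def successively.simps by blast
  then have "card {v0, v2, v4, v6} \<le> degree (A \<union> B) E v3"
    using finite_A finite_B unfolding degree_def by (intro card_mono) auto
  also have "\<dots> = 3" using \<open>E v3 v6\<close> edge by (intro degree_3) blast
  finally show False using assms(1) by (simp add: path_def)
qed

lemma cycle_rotate_to_chordless:
  assumes "cycle E xs" "7 \<le> length xs"
  obtains a b c d zs where "cycle E (a # b # c # d # zs)" "set (a # b # c # d # zs) = set xs"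
    "\<not> E a d"
proof -
  obtain v0 v1 v2 v3 v4 v5 v6 vs where xs: "xs = v0 # v1 # v2 # v3 # v4 # v5 # v6 # vs"
    using assms(2) by (auto simp: numeral_eq_Suc Suc_le_length_iff)
  show thesis
  proof (cases "E v0 v3")
    case True
    then have "\<not> E v3 v6" using assms(1) no_consecutive_chords by (auto simp: xs cycle_def)
    moreover have "cycle E (v3 # v4 # v5 # v6 # vs @ [v0, v1, v2])"
      using cycle_append_commute[of E "[v0, v1, v2]" "v3 # v4 # v5 # v6 # vs"] assms(1)
      by (simp add: xs)
    ultimately show thesis using that[of v3 v4 v5 v6 "vs @ [v0, v1, v2]"] by (auto simp: xs)
  qed (use that assms(1) xs in blast)
qed

lemma small_IPD_path_two_mod_3:
  assumes path: "path E (a # b # c # d # e # f # g # h # zs)" and "\<not> E a d" "3 dvd length zs"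
  shows "small_IPD (set (a # b # c # d # e # f # g # h # zs)) E"
proof (cases "E b e")
  case True
  then have "\<not> E e h" using path no_consecutive_chords[of b c d e f g h zs] by (simp add: path_def)
  then have "small_IPD (set ([a, b, c, d] @ [e, f, g, h])) E"
    using path assms(2) small_IPD_4 by (intro small_IPD_append) (auto simp: path_def)
  then show ?thesis
    using small_IPD_append_path[of "[a, b, c, d, e, f, g, h]" zs] path assms(3) by simp
next
  case False
  then have "small_IPD {a, b, c, d, e} E"
    using path assms(2) by (intro small_IPD_5) (auto simp: path_def)
  moreover have "3 dvd length (f # g # h # zs)" using assms(3) by (simp, presburger)
  ultimately show ?thesis
    using small_IPD_append_path[of "[a, b, c, d, e]" "f # g # h # zs"] path by simp
qed

lemma small_IPD_cycle:
  assumes "cycle E xs" "length xs \<noteq> 4"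
  shows "small_IPD (set xs) E"
proof (cases "3 dvd length xs")
  case True
  then show ?thesis using assms(1) by (intro small_IPD_path) (auto simp: cycle_def)
next
  case False
  have "3 \<le> length xs" using assms(1) by (simp add: cycle_def)
  then have "7 \<le> length xs" using False even_length_cycle[OF assms(1)] assms(2) by presburger
  then obtain a b c d zs where zs: "cycle E (a # b # c # d # zs)"
      "set (a # b # c # d # zs) = set xs"
    and no_chord: "\<not> E a d"
    using cycle_rotate_to_chordless[OF assms(1)] by blast
  have path: "path E ([a, b, c, d] @ zs)" using zs(1) by (simp add: cycle_def)
  have length: "length xs = length zs + 4"
    using length_cycle[OF assms(1)] length_cycle[OF zs(1)] zs(2) by simp
  have "small_IPD (set ([a, b, c, d] @ zs)) E"
  proof (cases "3 dvd length zs")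
    case True
    have "small_IPD {a, b, c, d} E" using path no_chord by (intro small_IPD_4) (auto simp: path_def)
    then show ?thesis using small_IPD_append_path[OF path] True by simp
  next
    case not_dvd: False
    then have "4 \<le> length zs" "3 dvd length zs - 4"
      using False even_length_cycle[OF assms(1)] \<open>7 \<le> length xs\<close> unfolding length by presburger+
    moreover from this(1) obtain e f g h us where "zs = e # f # g # h # us"
      by (auto simp: numeral_eq_Suc Suc_le_length_iff)
    ultimately show ?thesis
      using small_IPD_path_two_mod_3[of a b c d e f g h us] path no_chord by simp
  qed
  then show ?thesis using zs(2) by simp
qed

lemma small_IPD_cycle_cover:
  assumes "cycle_cover E V Q" "\<And>xs. xs \<in> Q \<Longrightarrow> length xs \<noteq> 4"
  shows "small_IPD V E"
proof -
  have "small_IPD (\<Union>xs\<in>Q. set xs) E"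
    using assms small_IPD_cycle by (intro small_IPD_UN) (auto simp: cycle_cover_def)
  then show ?thesis using assms(1) by (simp add: cycle_cover_def)
qed

end

section \<open>A cycle cover without 4-cycles\<close>

context bipartite_cubic_graph
begin

lemma bipartite_cubic_graph_flip: "bipartite_cubic_graph B A E"
  using simple disjoint edge cubic by unfold_locales (auto simp: Un_commute)

lemma card_edges_from_A:
  assumes "a \<in> A"
  shows "card {b \<in> B. E a b} = 3"
proof -
  have "{b \<in> B. E a b} = {b \<in> A \<union> B. E a b}" using assms edge disjoint by blast
  then show ?thesis using degree_3[of a] assms by (simp add: degree_def)
qed

lemma regular_weight_edges: "regular_weight 3 A B (\<lambda>a b. of_bool (E a b))"
proof -
  have "{a \<in> A. E a b} = {a \<in> A. E b a}" for b using sympD[OF symp_E] by blast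
  then show ?thesis
    using card_edges_from_A bipartite_cubic_graph.card_edges_from_A[OF bipartite_cubic_graph_flip]
    by (simp add: regular_weight_def finite_A finite_B Int_def)
qed

definition four_cycles :: "'a set set" where
  "four_cycles = {set xs |xs. cycle E xs \<and> length xs = 4}"

lemma card_four_cycle: "C \<in> four_cycles \<Longrightarrow> card C = 4"
  by (auto simp: four_cycles_def length_cycle)

lemma four_cycle_subset: "C \<in> four_cycles \<Longrightarrow> C \<subseteq> A \<union> B"
  using set_cycle_subset by (auto simp: four_cycles_def)

lemma four_cycleE:
  assumes "C \<in> four_cycles"
  obtains p q r s where "C \<inter> A = {p, q}" "C \<inter> B = {r, s}" "p \<noteq> q" "r \<noteq> s"
    "E p r" "E p s" "E q r" "E q s"
proof -
  obtain xs where xs: "cycle E xs" "length xs = 4" "C = set xs"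
    using assms by (auto simp: four_cycles_def)
  then have "xs \<noteq> []" by auto
  then have "hd xs \<in> set xs" "last xs \<in> set xs" by simp_all
  moreover have "E (last xs) (hd xs)" using xs(1) by (simp add: cycle_def)
  ultimately obtain p where "p \<in> set xs" "p \<in> A" using edge[of "last xs" "hd xs"] by blast
  then obtain zs where zs: "cycle E (p # zs)" "set xs = set (p # zs)"
    using cycle_rotate_to[OF xs(1)] by blast
  have "length zs = 3" using length_cycle[OF xs(1)] length_cycle[OF zs(1)] zs(2) xs(2) by simp
  then obtain r q s where rqs: "zs = [r, q, s]" by (auto simp: numeral_eq_Suc length_Suc_conv)
  have E: "E p r" "E q r" "E q s" "E p s" and ne: "p \<noteq> q" "r \<noteq> s"
    using zs(1) sympD[OF symp_E] by (auto simp: cycle_def path_def rqs)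
  then have "r \<in> B" "s \<in> B" "q \<in> A" using edge disjoint \<open>p \<in> A\<close> by blast+
  then have "C \<inter> A = {p, q}" "C \<inter> B = {r, s}"
    using xs(3) zs(2) disjoint \<open>p \<in> A\<close> by (auto simp: rqs)
  then show thesis using that E ne by blast
qed

lemma heavy_K22_four_cycle:
  assumes "C \<in> four_cycles"
  shows "heavy_K22 3 A B (\<lambda>a b. of_bool (E a b)) (C \<inter> A) (C \<inter> B)"
proof -
  obtain p q r s where "C \<inter> A = {p, q}" "C \<inter> B = {r, s}" "p \<noteq> q" "r \<noteq> s"
    "E p r" "E p s" "E q r" "E q s" using four_cycleE[OF assms] .
  then show ?thesis unfolding heavy_K22_def by auto
qed

definition isolated_four_cycles :: "'a set set" where
  "isolated_four_cycles = {C \<in> four_cycles. \<forall>D\<in>four_cycles. D \<noteq> C \<longrightarrow> C \<inter> D = {}}"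

lemma perfect_matching_meeting_isolated_four_cycles:
  "\<exists>f. perfect_matching A B E f \<and> (\<forall>C\<in>isolated_four_cycles. f ` (C \<inter> A) \<inter> (C \<inter> B) \<noteq> {})"
proof -
  let ?F = "(\<lambda>C. (C \<inter> A, C \<inter> B)) ` isolated_four_cycles" and ?w = "\<lambda>a b. of_bool (E a b) :: nat"
  have isolated: "C \<in> four_cycles" "D \<in> isolated_four_cycles \<Longrightarrow> C \<noteq> D \<Longrightarrow> C \<inter> D = {}"
    if "C \<in> isolated_four_cycles" for C D
    using that by (auto simp: isolated_four_cycles_def)
  have "isolated_four_cycles \<subseteq> Pow (A \<union> B)" using isolated(1) four_cycle_subset by blast
  then have "finite ?F" using finite_A finite_B
    by (meson finite_Un finite_Pow_iff finite_imageI finite_subset)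
  moreover have "disjoint_family_on fst ?F" "disjoint_family_on snd ?F"
    using isolated(2) unfolding disjoint_family_on_def by fastforce+
  ultimately have "\<exists>f. perfect_matching A B (\<lambda>a b. 0 < ?w a b) f \<and> (\<forall>(P, R)\<in>?F. f ` P \<inter> R \<noteq> {})"
    using finite_A finite_B regular_weight_edges isolated(1) heavy_K22_four_cycle
    by (intro perfect_matching_meeting_K22s[of _ _ _ 3]) auto
  then show ?thesis by fastforce
qed

definition unmatched :: "('a \<Rightarrow> 'a) \<Rightarrow> 'a \<Rightarrow> 'a \<Rightarrow> bool" where
  "unmatched f u v \<longleftrightarrow> E u v \<and> \<not> (u \<in> A \<and> v = f u) \<and> \<not> (v \<in> A \<and> u = f v)"

lemma degree_unmatched:
  assumes "perfect_matching A B E f" and v: "v \<in> A \<union> B"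
  shows "degree (A \<union> B) (unmatched f) v = 2"
proof -
  have f: "bij_betw f A B" "\<And>a. a \<in> A \<Longrightarrow> E a (f a)"
    using assms(1) by (auto simp: perfect_matching_def)
  obtain m where m: "E v m" "{u \<in> A \<union> B. unmatched f v u} = {u \<in> A \<union> B. E v u} - {m}"
  proof (cases "v \<in> A")
    case True
    then have "v \<notin> f ` A" using f(1) disjoint by (auto simp: bij_betw_def)
    then show thesis using that[of "f v"] True f(2) by (auto simp: unmatched_def)
  next
    case False
    then obtain a where a: "a \<in> A" "f a = v" using v f(1) by (auto simp: bij_betw_def)
    have "u \<in> A \<and> v = f u \<longleftrightarrow> u = a" for u
      using a f(1) by (auto simp: bij_betw_def inj_on_eq_iff)
    then show thesis using that[of a] False f(2)[OF a(1)] a sympD[OF symp_E]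
      by (auto simp: unmatched_def)
  qed
  then have "m \<in> {u \<in> A \<union> B. E v u}" using edge by blast
  then show ?thesis using degree_3[OF v] m(2) by (simp add: degree_def)
qed

lemma symp_unmatched: "symp (unmatched f)"
  using sympD[OF symp_E] by (auto simp: unmatched_def intro: sympI)

lemma cycle_cover_unmatched:
  assumes "perfect_matching A B E f"
  shows "\<exists>Q. cycle_cover (unmatched f) (A \<union> B) Q"
  using finite_A finite_B symp_unmatched irreflp_E degree_unmatched[OF assms]
  by (intro two_regular_cycle_cover) (auto simp: unmatched_def irreflp_def)

lemma unmatched_four_cycle_not_met:
  assumes "cycle (unmatched f) xs" "set xs \<in> four_cycles"
  shows "f ` (set xs \<inter> A) \<inter> (set xs \<inter> B) = {}"
proof (rule ccontr)
  assume "\<not> ?thesis"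
  then obtain a where a: "a \<in> set xs" "a \<in> A" "f a \<in> set xs \<inter> B" by blast
  obtain y z where yz: "y \<in> set xs" "z \<in> set xs" "y \<noteq> z" "unmatched f a y" "unmatched f a z"
    using cycle_two_neighbours[OF assms(1) symp_unmatched a(1)] .
  have "y \<in> B" "z \<in> B" using yz(4,5) edge[of a] disjoint a(2) by (auto simp: unmatched_def)
  then have "set xs \<inter> B = {y, z}"
    using yz(1-3) four_cycleE[OF assms(2)] by (metis IntI doubleton_eq_iff insertE singletonD)
  then show False using a yz(4,5) by (auto simp: unmatched_def)
qed

lemma cycle_cover_no_isolated_four_cycle:
  "\<exists>Q. cycle_cover E (A \<union> B) Q \<and> (\<forall>xs\<in>Q. set xs \<notin> isolated_four_cycles)"
proof -
  obtain f where f: "perfect_matching A B E f"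
    and meets: "\<And>C. C \<in> isolated_four_cycles \<Longrightarrow> f ` (C \<inter> A) \<inter> (C \<inter> B) \<noteq> {}"
    using perfect_matching_meeting_isolated_four_cycles by blast
  obtain Q where Q: "cycle_cover (unmatched f) (A \<union> B) Q" using cycle_cover_unmatched[OF f] by blast
  then have "set xs \<notin> isolated_four_cycles" if "xs \<in> Q" for xs
    using that meets[of "set xs"] unmatched_four_cycle_not_met[of f xs]
    by (auto simp: cycle_cover_def isolated_four_cycles_def)
  moreover have "cycle_cover E (A \<union> B) Q" using Q
    by (rule cycle_cover_mono) (simp add: unmatched_def)
  ultimately show ?thesis by blast
qed

lemma cycle_cover_fewer_cycles:
  assumes Q: "cycle_cover E (A \<union> B) Q"
    and xs: "xs \<in> Q" "length xs = 4" "set xs \<notin> isolated_four_cycles"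
  shows "\<exists>Q'. cycle_cover E (A \<union> B) Q' \<and> card Q' < card Q \<and> (\<forall>zs\<in>Q'. zs \<in> Q \<or> 4 < length zs)"
proof -
  have C: "set xs \<in> four_cycles" using Q xs(1,2) by (auto simp: cycle_cover_def four_cycles_def)
  with xs(3) obtain D where D: "D \<in> four_cycles" "D \<noteq> set xs" "D \<inter> set xs \<noteq> {}"
    by (auto simp: isolated_four_cycles_def)
  have "\<not> D \<subseteq> set xs"
    using D(2) card_subset_eq[of "set xs" D] card_four_cycle[OF D(1)] card_four_cycle[OF C]
    by auto
  moreover obtain ys where ys: "cycle E ys" "length ys = 4" "set ys = D"
    using D(1) by (auto simp: four_cycles_def)
  ultimately obtain v1 v2 zs where zs: "cycle E (v1 # v2 # zs)" "set (v1 # v2 # zs) = D"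
    "v1 \<notin> set xs" "v2 \<in> set xs"
    using cycle_rotate_entering[of E ys "set xs"] D(3) by metis
  have "length (v1 # v2 # zs) = 4"
    using length_cycle[OF zs(1)] zs(2) card_four_cycle[OF D(1)] by simp
  then obtain v3 v4 where "zs = [v3, v4]" by (auto simp: numeral_eq_Suc length_Suc_conv)
  then have "cycle E [v1, v2, v3, v4]" "set [v1, v2, v3, v4] \<subseteq> A \<union> B"
    using zs(1,2) four_cycle_subset[OF D(1)] by simp_all
  then show ?thesis
    using cycle_cover_merge[OF Q symp_E degree_3 xs(1) _ _ zs(3,4)] xs(2) by simp
qed

lemma cycle_cover_no_four_cycle: "\<exists>Q. cycle_cover E (A \<union> B) Q \<and> (\<forall>xs\<in>Q. length xs \<noteq> 4)"
proof -
  define admissible where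
    "admissible Q \<longleftrightarrow> cycle_cover E (A \<union> B) Q \<and> (\<forall>xs\<in>Q. set xs \<notin> isolated_four_cycles)" for Q
  obtain Q where Q: "admissible Q" and fewest: "\<And>Q'. admissible Q' \<Longrightarrow> card Q \<le> card Q'"
    using cycle_cover_no_isolated_four_cycle ex_has_least_nat[of admissible _ card]
    unfolding admissible_def by metis
  have "length xs \<noteq> 4" if xs: "xs \<in> Q" for xs
  proof
    assume "length xs = 4"
    then obtain Q' where Q': "cycle_cover E (A \<union> B) Q'" "card Q' < card Q"
      and new: "\<And>zs. zs \<in> Q' \<Longrightarrow> zs \<in> Q \<or> 4 < length zs"
      using cycle_cover_fewer_cycles[of Q xs] Q xs by (auto simp: admissible_def)
    have "set zs \<notin> isolated_four_cycles" if "zs \<in> Q'" for zs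
    proof -
      have "length zs = card (set zs)"
        using Q'(1) that length_cycle[of E] by (simp add: cycle_cover_def)
      then have "set zs \<notin> four_cycles" if "4 < length zs"
        using that card_four_cycle[of "set zs"] by auto
      then show ?thesis using new[OF that] Q by (auto simp: admissible_def isolated_four_cycles_def)
    qed
    then have "admissible Q'" using Q'(1) by (simp add: admissible_def)
    then show False using fewest Q'(2) by fastforce
  qed
  then show ?thesis using Q by (auto simp: admissible_def)
qed

end

theorem mainTheorem4:
  fixes V :: "'a set" and E :: "'a \<Rightarrow> 'a \<Rightarrow> bool" and n :: nat
  assumes "simple_graph V E" and "connected_graph V E" and "bipartite V E"
    and "cubic V E" and "card V = n"
  shows "has_IPD V E \<and> 3 * rho V E \<le> n"
proof -
  obtain A B where V: "V = A \<union> B" and "A \<inter> B = {}"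
    and "\<And>u v. E u v \<Longrightarrow> (u \<in> A \<and> v \<in> B) \<or> (u \<in> B \<and> v \<in> A)"
    using assms(3) unfolding bipartite_def by blast
  then interpret bipartite_cubic_graph A B E
    using assms(1,4) by unfold_locales auto
  obtain Q where "cycle_cover E V Q" "\<And>xs. xs \<in> Q \<Longrightarrow> length xs \<noteq> 4"
    using cycle_cover_no_four_cycle V by blast
  then show ?thesis
    using small_IPD_imp_has_IPD_rho_le[OF small_IPD_cycle_cover] assms(5) by blast
qed

end
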